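(* Let $j, k$ be positive integers and suppose there exist positive integers $n < N$ such that every integer $m$ with $n < m < N$ is $(j,k)$-representable. If $a$ is a positive integer with $a^k - (a-1)^k < N - n$, then every integer $m'$ with $n+1 < m' < N + a^k$ is $(j+1,k)$-representable.
   Context: For positive integers $j,k$, a positive integer $n$ is called $(j,k)$-representable if $n = x_1^k + \cdots + x_j^k$ with all $x_i$ positive integers. *)

theory Defs imports Main begin

definition representable :: "nat \<Rightarrow> nat \<Rightarrow> nat \<Rightarrow> bool" where
  "representable j k n \<longleftrightarrow>
     n > 0 \<and> (\<exists>x :: nat \<Rightarrow> nat. (\<forall>i\<in>{1..j}. x i > 0) \<and> n = (\<Sum>i=1..j. x i ^ k))"

end

theory Submission imports Defs begin

text \<open>
  Adding $b^k$ to the numbers strictly between $n$ and $N$ shows that every number strictly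
  between $n + b^k$ and $N + b^k$ is $(j+1,k)$-representable. The differences
  $b^k - (b-1)^k$ increase with $b$, so for $b \le a$ they all stay below $N - n$, and the
  intervals for $b = 1, \dots, a$ overlap without leaving a gap.
\<close>

lemma representable_add_power:
  assumes "representable j k m" and "b > 0"
  shows "representable (j + 1) k (m + b ^ k)"
proof -
  obtain x where m: "m > 0" and x: "\<forall>i\<in>{1..j}. x i > 0" "m = (\<Sum>i=1..j. x i ^ k)"
    using assms(1) unfolding representable_def by blast
  let ?y = "x(j + 1 := b)"
  have "(\<Sum>i=1..j. ?y i ^ k) = (\<Sum>i=1..j. x i ^ k)"
    by (rule sum.cong) auto
  then have "m + b ^ k = (\<Sum>i=1..j+1. ?y i ^ k)"
    using x(2) by simp
  moreover have "\<forall>i\<in>{1..j+1}. ?y i > 0"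
    using x(1) assms(2) by auto
  ultimately show ?thesis
    using m unfolding representable_def by (intro conjI exI[of _ ?y]) auto
qed

text \<open>The induction on \<open>k\<close> rests on the identity \<open>(x + 1) ^ Suc k - x ^ Suc
  k = (x + 1) * ((x + 1) ^ k - x ^ k) + x ^ k\<close>, in which both summands grow with
  \<open>x\<close> for \<open>x \<ge> 0\<close>.\<close>

lemma power_diff_mono:
  fixes x y :: "'a::linordered_idom"
  assumes "0 \<le> x" and "x \<le> y"
  shows "(x + 1) ^ k - x ^ k \<le> (y + 1) ^ k - y ^ k"
proof (induction k)
  case 0
  show ?case by simp
next
  case (Suc k)
  have "(x + 1) * ((x + 1) ^ k - x ^ k) \<le> (y + 1) * ((y + 1) ^ k - y ^ k)"
    using Suc assms by (intro mult_mono) (auto intro: power_mono)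
  moreover have "x ^ k \<le> y ^ k"
    using assms by (intro power_mono)
  ultimately show ?case
    by (simp add: algebra_simps)
qed

theorem theorem2p2:
  fixes j k n N a :: nat
  assumes "j > 0" and "k > 0"
    and "n > 0" and "n < N"
    and "\<forall>m. n < m \<and> m < N \<longrightarrow> representable j k m"
    and "a > 0"
    and "int a ^ k - (int a - 1) ^ k < int N - int n"
  shows "\<forall>m'. n + 1 < m' \<and> m' < N + a ^ k \<longrightarrow> representable (j + 1) k m'"
proof -
  have shift: "representable (j + 1) k m'"
    if "b > 0" "n + b ^ k < m'" "m' < N + b ^ k" for b m'
  proof -
    have "n < m' - b ^ k" and "m' - b ^ k < N"
      using that by linarith+
    then have "representable j k (m' - b ^ k)"
      using assms(5) by blast
    from representable_add_power[OF this that(1)] show ?thesis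
      using that(2) by simp
  qed
  have overlap: "n + Suc b ^ k < N + b ^ k" if "Suc b \<le> a" for b
  proof -
    \<comment> \<open>Working over \<open>int\<close> avoids truncated subtraction. Since
      \<open>b \<le> a - 1\<close>, the gap after \<open>b\<close> is at most the last gap, the one
      that the hypothesis on \<open>a\<close> bounds.\<close>
    have "(int b + 1) ^ k - int b ^ k \<le> (int a - 1 + 1) ^ k - (int a - 1) ^ k"
      using that by (intro power_diff_mono) auto
    then have "int (n + Suc b ^ k) < int (N + b ^ k)"
      using assms(7) by (simp add: add.commute)
    then show ?thesis
      by (simp only: of_nat_less_iff)
  qed
  have "\<forall>m'. n + 1 < m' \<and> m' < N + b ^ k \<longrightarrow> representable (j + 1) k m'"
    if "1 \<le> b" "b \<le> a" for b
    using that
  proof (induction b rule: dec_induct)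
    case base
    \<comment> \<open>As \<open>1 ^ k = 1\<close>, this interval supplies the lower end
      \<open>n + 1\<close>.\<close>
    show ?case using shift[of 1] by simp
  next
    case (step b)
    show ?case
    proof (intro allI impI)
      fix m' assume m': "n + 1 < m' \<and> m' < N + Suc b ^ k"
      show "representable (j + 1) k m'"
      proof (cases "m' < N + b ^ k")
        case True
        then show ?thesis using step m' by simp
      next
        case False
        \<comment> \<open>Here \<open>N + b ^ k \<le> m'\<close>, so by the overlap
          \<open>m'\<close> already lies in the interval shifted by
          \<open>Suc b ^ k\<close>.\<close>
        then have "n + Suc b ^ k < m'" using overlap[OF step.prems] by linarith
        then show ?thesis using shift[of "Suc b" m'] m' by blast
      qed
    qed
  qed
  from this[of a] show ?thesis using assms(6) by simp
qed

end
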